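(* Let $G$ be a connected non-trivial graph of order $n$, let $\mathcal{H}=\{H_1,\dots,H_n\}$ be a family of $n$ non-trivial graphs, and let $k$ be a positive integer. Then $G\odot\mathcal{H}$ is $k$-metric dimensional if and only if $k=\mathcal{C}(\mathcal{H})$.
   Context: All graphs are finite, simple and undirected; a graph is non-trivial if it has at least two vertices. For a connected graph $\Gamma$, $d_\Gamma(x,y)$ is the length of a shortest path between $x$ and $y$. For a positive integer $k$, a set $S\subseteq V(\Gamma)$ is a $k$-metric generator for $\Gamma$ if for any two different vertices $u,v$ of $\Gamma$ there are at least $k$ vertices $w\in S$ with $d_\Gamma(u,w)\neq d_\Gamma(v,w)$. A $k$-metric basis is a $k$-metric generator of minimum cardinality. A connected graph is $k'$-metric dimensional if $k'$ is the largest integer for which a $k'$-metric basis exists. Corona product: if $G$ has vertices $v_1,\dots,v_n$ and $\mathcal{H}=\{H_1,\dots,H_n\}$ is a family of $n$ graphs (repetitions up to isomorphism allowed), $G\odot\mathcal{H}$ is obtained from the disjoint union of $G$ and $H_1,\dots,H_n$ by joining, for each $i$, the vertex $v_i$ by an edge to every vertex of $H_i$. For a non-trivial graph $H$, $N_H(x)$ is the open neighborhood of $x$, $\triangledown$ is the symmetric difference of sets, and $$\mathcal{C}(H)=\min_{x,y\in V(H),\,x\ne y}\left|(N_H(x)\triangledown N_H(y))\cup\{x,y\}\right|,\qquad \mathcal{C}(\mathcal{H})=\min_{H_i\in\mathcal{H}}\mathcal{C}(H_i).$$ *)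

theory Defs
  imports "Graph_Theory.Graph_Theory"
begin

text \<open>
  A finite simple undirected graph is a \<^const>\<open>pair_graph\<close>: a finite vertex set with a symmetric,
  irreflexive set of arcs, so that every undirected edge is a pair of opposite arcs.
\<close>

definition nontrivial_graph :: "'a pair_pre_digraph \<Rightarrow> bool" where
  "nontrivial_graph G \<longleftrightarrow> pair_graph G \<and> 2 \<le> card (pverts G)"

text \<open>Only meaningful if some path joins \<open>x\<close> and \<open>y\<close>, in particular in connected graphs.\<close>

definition gdist :: "'a pair_pre_digraph \<Rightarrow> 'a \<Rightarrow> 'a \<Rightarrow> nat" where
  "gdist G x y = (LEAST l. \<exists>p. pre_digraph.apath (with_proj G) x p y \<and> length p = l)"

definition k_metric_generator :: "nat \<Rightarrow> 'a pair_pre_digraph \<Rightarrow> 'a set \<Rightarrow> bool" where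
  "k_metric_generator k G S \<longleftrightarrow> 0 < k \<and> S \<subseteq> pverts G \<and>
     (\<forall>u\<in>pverts G. \<forall>v\<in>pverts G. u \<noteq> v \<longrightarrow> k \<le> card {w \<in> S. gdist G u w \<noteq> gdist G v w})"

definition k_metric_basis :: "nat \<Rightarrow> 'a pair_pre_digraph \<Rightarrow> 'a set \<Rightarrow> bool" where
  "k_metric_basis k G S \<longleftrightarrow> is_arg_min card (k_metric_generator k G) S"

definition k_metric_dimensional :: "nat \<Rightarrow> 'a pair_pre_digraph \<Rightarrow> bool" where
  "k_metric_dimensional k G \<longleftrightarrow> connected (with_proj G) \<and>
     (\<exists>S. k_metric_basis k G S) \<and> (\<forall>k'. (\<exists>S. k_metric_basis k' G S) \<longrightarrow> k' \<le> k)"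

text \<open>
  The family is indexed by the vertices of \<open>G\<close>, so \<open>H v\<close> is the graph attached to \<open>v\<close>; its copy
  in the disjoint union consists of the vertices \<open>Inr (v, x)\<close>.
\<close>

definition corona :: "'a pair_pre_digraph \<Rightarrow> ('a \<Rightarrow> 'b pair_pre_digraph) \<Rightarrow>
    ('a + 'a \<times> 'b) pair_pre_digraph" where
  "corona G H = \<lparr>
     pverts = Inl ` pverts G \<union> Inr ` (SIGMA v:pverts G. pverts (H v)),
     parcs = {(Inl u, Inl v) | u v. (u, v) \<in> parcs G}
       \<union> {(Inr (v, x), Inr (v, y)) | v x y. v \<in> pverts G \<and> (x, y) \<in> parcs (H v)}
       \<union> {(Inl v, Inr (v, x)) | v x. v \<in> pverts G \<and> x \<in> pverts (H v)}
       \<union> {(Inr (v, x), Inl v) | v x. v \<in> pverts G \<and> x \<in> pverts (H v)} \<rparr>"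

lemma pair_graph_corona:
  assumes "pair_graph G" and "\<And>v. v \<in> pverts G \<Longrightarrow> pair_graph (H v)"
  shows "pair_graph (corona G H)"
proof -
  interpret G: pair_graph G by fact
  have H: "finite (pverts (H v))" "(x, y) \<in> parcs (H v) \<Longrightarrow> x \<in> pverts (H v) \<and> y \<in> pverts (H v)"
    "(x, x) \<notin> parcs (H v)" "(x, y) \<in> parcs (H v) \<Longrightarrow> (y, x) \<in> parcs (H v)"
    if "v \<in> pverts G" for v x y
  proof -
    interpret H: pair_graph "H v" using assms(2) that .
    show "finite (pverts (H v))"
      by (rule H.pair_finite_verts)
    show "(x, x) \<notin> parcs (H v)"
      using H.pair_no_loops[of "(x, x)"] by auto
    show "(x, y) \<in> parcs (H v) \<Longrightarrow> x \<in> pverts (H v) \<and> y \<in> pverts (H v)"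
      using H.in_arcsD1 H.in_arcsD2 by blast
    show "(x, y) \<in> parcs (H v) \<Longrightarrow> (y, x) \<in> parcs (H v)"
      using H.pair_sym_arcs by (auto simp: symmetric_def sym_def)
  qed
  have fin: "finite (pverts (corona G H))"
    by (auto simp: corona_def H(1) G.pair_finite_verts)
  have arcs: "parcs (corona G H) \<subseteq> pverts (corona G H) \<times> pverts (corona G H)"
    using H(2) by (auto simp: corona_def dest: G.in_arcsD1 G.in_arcsD2)
  have sym: "(b, a) \<in> parcs (corona G H)" if "(a, b) \<in> parcs (corona G H)" for a b
  proof -
    have G_sym: "(v, u) \<in> parcs G" if "(u, v) \<in> parcs G" for u v
      using G.pair_sym_arcs that by (simp add: symmetric_def sym_def)
    show ?thesis
      using that unfolding corona_def by simp (elim disjE exE conjE; simp add: G_sym H(4))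
  qed
  have irrefl: "(a, a) \<notin> parcs (corona G H)" for a
    using G.pair_no_loops[of "(u, u)" for u] H(3) by (auto simp: corona_def)
  show ?thesis
  proof unfold_locales
    fix e assume e: "e \<in> parcs (corona G H)"
    show "fst e \<in> pverts (corona G H)" "snd e \<in> pverts (corona G H)"
      using subsetD[OF arcs e] by (simp_all add: mem_Times_iff)
    show "fst e \<noteq> snd e"
      using e irrefl[of "fst e"] by (metis prod.collapse)
  next
    show "finite (pverts (corona G H))"
      by (rule fin)
    show "finite (parcs (corona G H))"
      by (rule finite_subset[OF arcs]) (simp add: fin)
    show "symmetric (with_proj (corona G H))"
      unfolding symmetric_def with_proj_simps by (rule symI) (rule sym)
  qed
qed

definition nbhd :: "'a pair_pre_digraph \<Rightarrow> 'a \<Rightarrow> 'a set" where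
  "nbhd H x = {y. x \<rightarrow>\<^bsub>with_proj H\<^esub> y}"

definition cal_C :: "'a pair_pre_digraph \<Rightarrow> nat" where
  "cal_C H = Min {card (sym_diff (nbhd H x) (nbhd H y) \<union> {x, y}) | x y.
     x \<in> pverts H \<and> y \<in> pverts H \<and> x \<noteq> y}"

definition cal_C_family :: "'i set \<Rightarrow> ('i \<Rightarrow> 'a pair_pre_digraph) \<Rightarrow> nat" where
  "cal_C_family I H = Min ((\<lambda>i. cal_C (H i)) ` I)"

end

theory Submission
  imports Defs
begin

text \<open>
  A superset of a \<open>k\<close>-metric generator is again one, so a \<open>k\<close>-metric basis exists exactly when
  the whole vertex set is a \<open>k\<close>-metric generator, that is, when every two vertices are
  distinguished by at least \<open>k\<close> vertices. A connected graph is therefore \<open>k\<close>-metric dimensional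
  for the least number of vertices that distinguish some pair, and this minimum has to be
  identified with \<open>\<C>(\<H>)\<close>.

  In the corona every copy hangs on the rest of the graph through one cut vertex, its root.
  Hence a vertex outside a copy is equally far from all vertices of the copy
  (\<open>gdist_leave_copy\<close>). Two vertices \<open>x\<close>, \<open>y\<close> of the same copy can then only be distinguished
  inside that copy; because all distances in there are at most 2, the vertices that do so are
  \<open>x\<close>, \<open>y\<close> and those adjacent to exactly one of them (\<open>resolvers_same_copy\<close>). These pairs
  produce precisely the numbers over which \<open>\<C>(\<H>)\<close> is the minimum.

  No other pair gives a smaller number: two vertices that do not lie in a common copy are
  distinguished by all vertices of some copy (\<open>copy_resolves_other_pairs\<close>), and no copy has fewer
  than \<open>\<C>(\<H>)\<close> vertices.
\<close>

section \<open>Distances in graphs\<close>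

context pair_graph
begin

text \<open>
  Shortest paths may be replaced by shortest walks, which can be composed freely: shortening a
  walk to a path only deletes arcs, and a path never repeats an arc.
\<close>

lemma gdist_le_length_awalk:
  assumes "awalk x p y"
  shows "gdist G x y \<le> length p"
proof -
  let ?q = "awalk_to_apath p"
  have q: "apath x ?q y"
    using assms by (rule apath_awalk_to_apath)
  have "distinct ?q"
    using q unfolding apath_def by (metis distinct_verts_imp_distinct)
  then have "length ?q = card (set ?q)"
    by (simp add: distinct_card)
  also have "\<dots> \<le> card (set p)"
    using awalk_to_apath_subset[OF assms] by (intro card_mono) auto
  also have "\<dots> \<le> length p"
    by (rule card_length)
  finally have "length ?q \<le> length p" .
  moreover have "gdist G x y \<le> length ?q"
    unfolding gdist_def by (rule Least_le) (use q in blast)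
  ultimately show ?thesis by simp
qed

lemma shortest_awalk:
  assumes "x \<rightarrow>\<^sup>*\<^bsub>with_proj G\<^esub> y"
  obtains p where "awalk x p y" "length p = gdist G x y"
proof -
  obtain p where "apath x p y"
    using assms by (auto simp: reachable_awalk dest: apath_awalk_to_apath)
  then have "\<exists>l q. apath x q y \<and> length q = l"
    by blast
  then have "\<exists>q. apath x q y \<and> length q = gdist G x y"
    unfolding gdist_def by (rule LeastI_ex)
  then show thesis
    using that by (auto simp: apath_def)
qed

lemma gdist_le_0_iff:
  assumes "x \<rightarrow>\<^sup>*\<^bsub>with_proj G\<^esub> y"
  shows "gdist G x y \<le> 0 \<longleftrightarrow> x = y"
proof
  show "gdist G x y \<le> 0 \<Longrightarrow> x = y"
    by (rule shortest_awalk[OF assms]) (auto simp: awalk_Nil_iff)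
  show "x = y \<Longrightarrow> gdist G x y \<le> 0"
    using gdist_le_length_awalk[of x "[]" y] reachable_in_verts[OF assms]
    by (simp add: awalk_Nil_iff)
qed

lemma gdist_le_1_iff:
  assumes "x \<rightarrow>\<^sup>*\<^bsub>with_proj G\<^esub> y"
  shows "gdist G x y \<le> 1 \<longleftrightarrow> x = y \<or> (x, y) \<in> parcs G"
proof
  assume le: "gdist G x y \<le> 1"
  obtain p where p: "awalk x p y" "length p = gdist G x y"
    by (rule shortest_awalk[OF assms])
  show "x = y \<or> (x, y) \<in> parcs G"
  proof (cases p)
    case Nil
    then show ?thesis using p by (auto simp: awalk_Nil_iff)
  next
    case (Cons e es)
    then have "length es + 1 = gdist G x y" using p(2) by simp
    then have "es = []" using le by (metis add_le_same_cancel2 le_zero_eq length_0_conv)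
    then show ?thesis using p Cons by (auto simp: awalk_simps)
  qed
next
  assume "x = y \<or> (x, y) \<in> parcs G"
  then show "gdist G x y \<le> 1"
  proof
    assume "x = y"
    then show ?thesis using gdist_le_0_iff[OF assms] by simp
  next
    assume "(x, y) \<in> parcs G"
    then have "awalk x [(x, y)] y"
      using arc_implies_awalk[of "(x, y)"] by simp
    then have "gdist G x y \<le> length [(x, y)]"
      by (rule gdist_le_length_awalk)
    then show ?thesis by simp
  qed
qed

lemma gdist_le_Suc_gdist:
  assumes "(x, y) \<in> parcs G" "y \<rightarrow>\<^sup>*\<^bsub>with_proj G\<^esub> z"
  shows "gdist G x z \<le> gdist G y z + 1"
proof -
  obtain p where p: "awalk y p z" "length p = gdist G y z"
    by (rule shortest_awalk[OF assms(2)])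
  then have "awalk x ((x, y) # p) z"
    using assms(1) by (simp add: awalk_Cons_iff)
  then have "gdist G x z \<le> length ((x, y) # p)"
    by (rule gdist_le_length_awalk)
  then show ?thesis
    using p(2) by simp
qed

text \<open>
  Lower bounds on distances are witnessed by potentials: a function that drops by at most one
  along each arc cannot drop by more than the distance.
\<close>

lemma potential_le_gdist:
  assumes step: "\<And>a b. (a, b) \<in> parcs G \<Longrightarrow> f a \<le> f b + (1::nat)"
    and "x \<rightarrow>\<^sup>*\<^bsub>with_proj G\<^esub> y"
  shows "f x \<le> f y + gdist G x y"
proof -
  have "f x \<le> f y + length p" if "awalk x p y" for p
    using that
  proof (induction p arbitrary: x)
    case Nil
    then show ?case by (simp add: awalk_Nil_iff)
  next
    case (Cons e es)
    have "f x \<le> f (snd e) + 1"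
      using Cons.prems step by (cases e) (auto simp: awalk_Cons_iff)
    moreover have "f (snd e) \<le> f y + length es"
      using Cons.prems by (intro Cons.IH) (auto simp: awalk_Cons_iff)
    ultimately show ?case by simp
  qed
  moreover obtain p where "awalk x p y" "length p = gdist G x y"
    by (rule shortest_awalk[OF assms(2)])
  ultimately show ?thesis by metis
qed

end

section \<open>Metric bases and distinguishing vertices\<close>

definition resolvers :: "'a pair_pre_digraph \<Rightarrow> 'a \<Rightarrow> 'a \<Rightarrow> 'a set" where
  "resolvers G u v = {w \<in> pverts G. gdist G u w \<noteq> gdist G v w}"

lemma resolvers_commute: "resolvers G u v = resolvers G v u"
  by (auto simp: resolvers_def)

lemma k_metric_basis_exists_iff:
  assumes "finite (pverts G)"
  shows "(\<exists>S. k_metric_basis k G S) \<longleftrightarrow>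
    0 < k \<and> (\<forall>u\<in>pverts G. \<forall>v\<in>pverts G. u \<noteq> v \<longrightarrow> k \<le> card (resolvers G u v))"
    (is "_ \<longleftrightarrow> ?R")
proof
  assume "\<exists>S. k_metric_basis k G S"
  then obtain S where S: "k_metric_generator k G S"
    by (auto simp: k_metric_basis_def is_arg_min_def)
  have "k \<le> card (resolvers G u v)" if "u \<in> pverts G" "v \<in> pverts G" "u \<noteq> v" for u v
  proof -
    have "k \<le> card {w \<in> S. gdist G u w \<noteq> gdist G v w}"
      using S that by (simp add: k_metric_generator_def)
    also have "\<dots> \<le> card (resolvers G u v)"
      using S assms by (intro card_mono) (auto simp: k_metric_generator_def resolvers_def)
    finally show ?thesis .
  qed
  then show ?R
    using S by (simp add: k_metric_generator_def)
next
  assume ?R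
  then have "k_metric_generator k G (pverts G)"
    by (simp add: k_metric_generator_def resolvers_def)
  then show "\<exists>S. k_metric_basis k G S"
    unfolding k_metric_basis_def by (blast intro: is_arg_min_arg_min_nat)
qed

section \<open>The parameter \<open>\<C>\<close>\<close>

lemma nbhd_subset_pverts:
  assumes "pair_graph H"
  shows "nbhd H x \<subseteq> pverts H"
proof -
  interpret pair_graph H by fact
  show ?thesis
    by (auto simp: nbhd_def dest: in_arcsD2)
qed

lemma cal_C_values_finite:
  assumes "finite (pverts H)"
  shows "finite {card (sym_diff (nbhd H x) (nbhd H y) \<union> {x, y}) | x y.
     x \<in> pverts H \<and> y \<in> pverts H \<and> x \<noteq> y}" (is "finite ?A")
proof -
  have "?A \<subseteq> (\<lambda>(x, y). card (sym_diff (nbhd H x) (nbhd H y) \<union> {x, y})) ` (pverts H \<times> pverts H)"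
    by auto
  then show ?thesis
    by (rule finite_subset) (simp add: assms)
qed

text \<open>A graph has to be non-trivial for the minimum to range over a nonempty set.\<close>

lemma le_cal_C_iff:
  assumes "nontrivial_graph H"
  shows "k \<le> cal_C H \<longleftrightarrow> (\<forall>x\<in>pverts H. \<forall>y\<in>pverts H. x \<noteq> y \<longrightarrow>
    k \<le> card (sym_diff (nbhd H x) (nbhd H y) \<union> {x, y}))"
proof -
  interpret pair_graph H
    using assms by (simp add: nontrivial_graph_def)
  have "\<exists>x y. x \<in> pverts H \<and> y \<in> pverts H \<and> x \<noteq> y"
    using assms card_le_Suc0_iff_eq[OF pair_finite_verts] by (auto simp: nontrivial_graph_def)
  then show ?thesis
    unfolding cal_C_def
    by (subst Min_ge_iff) (use cal_C_values_finite[OF pair_finite_verts] in auto)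
qed

lemma cal_C_le_card_pverts:
  assumes "nontrivial_graph H"
  shows "cal_C H \<le> card (pverts H)"
proof -
  interpret pair_graph H
    using assms by (simp add: nontrivial_graph_def)
  obtain x y where xy: "x \<in> pverts H" "y \<in> pverts H" "x \<noteq> y"
    using assms card_le_Suc0_iff_eq[OF pair_finite_verts] by (auto simp: nontrivial_graph_def)
  have "cal_C H \<le> card (sym_diff (nbhd H x) (nbhd H y) \<union> {x, y})"
    using le_cal_C_iff[OF assms, of "cal_C H"] xy by blast
  also have "\<dots> \<le> card (pverts H)"
    using xy pair_finite_verts nbhd_subset_pverts[OF pair_graph]
    by (intro card_mono) blast+
  finally show ?thesis .
qed

lemma cal_C_ge_2:
  assumes "nontrivial_graph H"
  shows "2 \<le> cal_C H"
proof -
  interpret pair_graph H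
    using assms by (simp add: nontrivial_graph_def)
  have "2 \<le> card (sym_diff (nbhd H x) (nbhd H y) \<union> {x, y})" if "x \<noteq> y" for x y
  proof -
    have "finite (nbhd H z)" for z
      using nbhd_subset_pverts[OF pair_graph] pair_finite_verts by (rule finite_subset)
    then have "card {x, y} \<le> card (sym_diff (nbhd H x) (nbhd H y) \<union> {x, y})"
      by (intro card_mono) simp_all
    then show ?thesis using that by simp
  qed
  then show ?thesis
    unfolding le_cal_C_iff[OF assms] by blast
qed

lemma le_cal_C_family_iff:
  assumes "finite I" "I \<noteq> {}"
  shows "k \<le> cal_C_family I H \<longleftrightarrow> (\<forall>i\<in>I. k \<le> cal_C (H i))"
  using assms by (simp add: cal_C_family_def)

section \<open>Distances in the corona\<close>

locale corona_graph =
  fixes G :: "'a pair_pre_digraph"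
    and H :: "'a \<Rightarrow> 'b pair_pre_digraph"
  assumes nontrivial_G: "nontrivial_graph G"
    and connected_G: "connected (with_proj G)"
    and nontrivial_H: "v \<in> pverts G \<Longrightarrow> nontrivial_graph (H v)"
begin

sublocale G: pair_graph G
  using nontrivial_G by (simp add: nontrivial_graph_def)

sublocale K: pair_graph "corona G H"
  using nontrivial_H G.pair_graph by (intro pair_graph_corona) (auto simp: nontrivial_graph_def)

abbreviation dist_K :: "'a + 'a \<times> 'b \<Rightarrow> 'a + 'a \<times> 'b \<Rightarrow> nat" where
  "dist_K \<equiv> gdist (corona G H)"

definition copy :: "'a \<Rightarrow> ('a + 'a \<times> 'b) set" where
  "copy v = (\<lambda>x. Inr (v, x)) ` pverts (H v)"

lemma pverts_corona: "pverts (corona G H) = Inl ` pverts G \<union> (\<Union>v\<in>pverts G. copy v)"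
  by (auto simp: corona_def copy_def)

lemma arc_in_H: "v \<in> pverts G \<Longrightarrow> (x, y) \<in> parcs (H v) \<Longrightarrow> x \<in> pverts (H v) \<and> y \<in> pverts (H v)"
proof -
  assume v: "v \<in> pverts G" and a: "(x, y) \<in> parcs (H v)"
  interpret pair_graph "H v"
    using nontrivial_H[OF v] by (simp add: nontrivial_graph_def)
  show ?thesis using a in_arcsD1 in_arcsD2 by blast
qed

lemma card_copy: "card (copy v) = card (pverts (H v))"
  unfolding copy_def by (rule card_image) (simp add: inj_on_def)

lemma corona_arcs:
  "(Inl u, Inl v) \<in> parcs (corona G H) \<longleftrightarrow> (u, v) \<in> parcs G"
  "(Inl u, Inr (v, y)) \<in> parcs (corona G H) \<longleftrightarrow> u = v \<and> v \<in> pverts G \<and> y \<in> pverts (H v)"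
  "(Inr (u, x), Inl v) \<in> parcs (corona G H) \<longleftrightarrow> u = v \<and> v \<in> pverts G \<and> x \<in> pverts (H v)"
  "(Inr (u, x), Inr (v, y)) \<in> parcs (corona G H) \<longleftrightarrow>
     u = v \<and> v \<in> pverts G \<and> (x, y) \<in> parcs (H v)"
  by (auto simp: corona_def)

text \<open>Walks of \<open>G\<close> lift to the corona, and every vertex of a copy is adjacent to its root.\<close>

lemma reachable_corona:
  assumes "a \<in> pverts (corona G H)" "b \<in> pverts (corona G H)"
  shows "a \<rightarrow>\<^sup>*\<^bsub>with_proj (corona G H)\<^esub> b"
proof -
  have lift: "Inl u \<rightarrow>\<^sup>*\<^bsub>with_proj (corona G H)\<^esub> Inl v" if "u \<rightarrow>\<^sup>*\<^bsub>with_proj G\<^esub> v" for u v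
    using that
  proof (induction rule: G.converse_reachable_induct)
    case base
    then show ?case
      by (intro K.reachable_refl) (auto simp: pverts_corona)
  next
    case (step x y)
    then have "(Inl x, Inl y) \<in> parcs (corona G H)"
      by (simp add: corona_arcs)
    then show ?case
      using step.IH by (rule K.adj_reachable_trans)
  qed
  have roots: "Inl u \<rightarrow>\<^sup>*\<^bsub>with_proj (corona G H)\<^esub> Inl v" if "u \<in> pverts G" "v \<in> pverts G" for u v
    using G.symmetric_connected_imp_strongly_connected[OF G.pair_sym_arcs connected_G] that
    by (intro lift) (auto simp: strongly_connected_def)
  define root :: "'a + 'a \<times> 'b \<Rightarrow> 'a" where "root = case_sum id fst"
  have root: "root c \<in> pverts G \<and> c \<rightarrow>\<^sup>*\<^bsub>with_proj (corona G H)\<^esub> Inl (root c) \<and>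
      Inl (root c) \<rightarrow>\<^sup>*\<^bsub>with_proj (corona G H)\<^esub> c" if "c \<in> pverts (corona G H)" for c
  proof (cases c)
    case (Inl u)
    then show ?thesis
      using that by (simp add: root_def pverts_corona copy_def roots image_iff)
  next
    case (Inr p)
    then show ?thesis
      using that
      by (auto simp: pverts_corona copy_def root_def corona_arcs intro!: K.reachable_adjI)
  qed
  show ?thesis
    using root[OF assms(1)] root[OF assms(2)] roots[of "root a" "root b"]
    by (meson K.reachable_trans)
qed

lemma connected_corona: "connected (with_proj (corona G H))"
proof (rule K.connectedI)
  show "pverts (corona G H) \<noteq> {}"
    using nontrivial_G by (auto simp: pverts_corona nontrivial_graph_def)
  show "u \<rightarrow>\<^sup>*\<^bsub>mk_symmetric (with_proj (corona G H))\<^esub> v"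
    if "u \<in> pverts (corona G H)" "v \<in> pverts (corona G H)" for u v
    using that by (intro K.reachable_mk_symmetricI reachable_corona)
qed

lemma dist_K_eq_0_iff:
  assumes "a \<in> pverts (corona G H)" "b \<in> pverts (corona G H)"
  shows "dist_K a b = 0 \<longleftrightarrow> a = b"
  using K.gdist_le_0_iff[OF reachable_corona[OF assms]] by simp

lemma dist_K_le_1_iff:
  assumes "a \<in> pverts (corona G H)" "b \<in> pverts (corona G H)"
  shows "dist_K a b \<le> 1 \<longleftrightarrow> a = b \<or> (a, b) \<in> parcs (corona G H)"
  using K.gdist_le_1_iff[OF reachable_corona[OF assms]] .

lemma dist_K_step:
  assumes "(a, b) \<in> parcs (corona G H)" "c \<in> pverts (corona G H)"
  shows "dist_K a c \<le> dist_K b c + 1"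
  using assms K.in_arcsD2 by (intro K.gdist_le_Suc_gdist reachable_corona) auto

text \<open>
  The root of a copy separates it from the rest, so a walk that leaves the copy passes the root.
  The potential in the proof is the distance to \<open>w\<close>, replaced inside the copy by the value that
  is to be established there.
\<close>

lemma gdist_leave_copy:
  assumes v: "v \<in> pverts G" and x: "x \<in> pverts (H v)"
    and w: "w \<in> pverts (corona G H)" "w \<notin> copy v"
  shows "dist_K (Inr (v, x)) w = dist_K (Inl v) w + 1"
proof (rule antisym)
  show "dist_K (Inr (v, x)) w \<le> dist_K (Inl v) w + 1"
    using v x w by (intro dist_K_step) (auto simp: corona_arcs)
  define f where "f a = (if a \<in> copy v then dist_K (Inl v) w + 1 else dist_K a w)" for a
  have f_step: "f a \<le> f b + 1" if arc: "(a, b) \<in> parcs (corona G H)" for a b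
  proof -
    have "b \<in> copy v \<or> b = Inl v" if "a \<in> copy v"
      using that arc by (cases b) (auto simp: copy_def corona_arcs image_iff dest: arc_in_H)
    moreover have "a \<in> copy v \<or> a = Inl v" if "b \<in> copy v"
      using that arc by (cases a) (auto simp: copy_def corona_arcs image_iff dest: arc_in_H)
    moreover have "Inl v \<notin> copy v"
      by (auto simp: copy_def)
    ultimately show ?thesis
      using dist_K_step[OF arc w(1)] unfolding f_def by auto
  qed
  have "Inr (v, x) \<in> pverts (corona G H)"
    using v x by (auto simp: pverts_corona copy_def)
  then have "f (Inr (v, x)) \<le> f w + dist_K (Inr (v, x)) w"
    using w(1) by (intro K.potential_le_gdist f_step reachable_corona)
  moreover have "f (Inr (v, x)) = dist_K (Inl v) w + 1"
    using x by (simp add: f_def copy_def)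
  moreover have "f w = 0"
    using w by (simp add: f_def dist_K_eq_0_iff)
  ultimately show "dist_K (Inl v) w + 1 \<le> dist_K (Inr (v, x)) w"
    by simp
qed

lemma gdist_in_copy:
  assumes v: "v \<in> pverts G" and x: "x \<in> pverts (H v)" and z: "z \<in> pverts (H v)"
  shows "dist_K (Inr (v, x)) (Inr (v, z)) =
    (if x = z then 0 else if (x, z) \<in> parcs (H v) then 1 else 2)"
proof -
  have V: "Inr (v, x) \<in> pverts (corona G H)" "Inr (v, z) \<in> pverts (corona G H)"
    "Inl v \<in> pverts (corona G H)"
    using v x z by (auto simp: pverts_corona copy_def)
  have "dist_K (Inr (v, x)) (Inr (v, z)) \<le> dist_K (Inl v) (Inr (v, z)) + 1"
    using v x V by (intro dist_K_step) (simp_all add: corona_arcs)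
  moreover have "dist_K (Inl v) (Inr (v, z)) \<le> 1"
    using v z V by (simp add: dist_K_le_1_iff[simplified] corona_arcs)
  ultimately show ?thesis
    using dist_K_eq_0_iff[OF V(1,2)] dist_K_le_1_iff[OF V(1,2)] v
    by (auto simp: corona_arcs)
qed

section \<open>Pairs of vertices in the corona\<close>

lemma resolvers_same_copy:
  assumes v: "v \<in> pverts G" and x: "x \<in> pverts (H v)" and y: "y \<in> pverts (H v)" and "x \<noteq> y"
  shows "resolvers (corona G H) (Inr (v, x)) (Inr (v, y)) =
    (\<lambda>z. Inr (v, z)) ` (sym_diff (nbhd (H v) x) (nbhd (H v) y) \<union> {x, y})" (is "?L = ?R")
proof -
  have "?L \<subseteq> copy v"
  proof
    fix w assume "w \<in> ?L"
    then show "w \<in> copy v"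
      using gdist_leave_copy[OF v x, of w] gdist_leave_copy[OF v y, of w]
      by (cases "w \<in> copy v") (simp_all add: resolvers_def)
  qed
  moreover have "?R \<subseteq> copy v"
    using v x y by (auto simp: nbhd_def copy_def dest: arc_in_H)
  moreover have "Inr (v, z) \<in> ?L \<longleftrightarrow> Inr (v, z) \<in> ?R" if z: "z \<in> pverts (H v)" for z
  proof -
    have "Inr (v, z) \<in> pverts (corona G H)"
      using v z by (auto simp: pverts_corona copy_def)
    then show ?thesis
      using \<open>x \<noteq> y\<close>
      by (auto simp: resolvers_def nbhd_def gdist_in_copy[OF v x z] gdist_in_copy[OF v y z]
          split: if_splits)
  qed
  ultimately show ?thesis
    unfolding copy_def by blast
qed

text \<open>
  The next three bounds make every vertex of a copy tell its root from all other roots and from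
  the vertices of other copies; since distances inside a copy are at most 2, the last bound also
  separates the vertices of the copy from those of other copies.
\<close>

lemma dist_root_to_copy:
  assumes "v \<in> pverts G" "w \<in> copy v"
  shows "dist_K (Inl v) w = 1"
proof -
  have V: "Inl v \<in> pverts (corona G H)" "w \<in> pverts (corona G H)"
    using assms by (auto simp: pverts_corona)
  have "dist_K (Inl v) w \<le> 1"
    using dist_K_le_1_iff[OF V] assms by (auto simp: corona_arcs copy_def)
  moreover have "dist_K (Inl v) w \<noteq> 0"
    using dist_K_eq_0_iff[OF V] assms by (auto simp: copy_def)
  ultimately show ?thesis by simp
qed

lemma dist_other_root_to_copy:
  assumes "u \<in> pverts G" "v \<in> pverts G" "u \<noteq> v" "w \<in> copy v"
  shows "2 \<le> dist_K (Inl u) w"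
proof -
  have V: "Inl u \<in> pverts (corona G H)" "w \<in> pverts (corona G H)"
    using assms by (auto simp: pverts_corona)
  have "\<not> dist_K (Inl u) w \<le> 1"
    using dist_K_le_1_iff[OF V] assms by (auto simp: corona_arcs copy_def)
  then show ?thesis by simp
qed

lemma dist_other_copy_to_copy:
  assumes "u \<in> pverts G" "v \<in> pverts G" "u \<noteq> v" "w \<in> copy v" "a \<in> copy u"
  shows "3 \<le> dist_K a w"
proof -
  have "w \<in> pverts (corona G H)" "w \<notin> copy u"
    using assms by (auto simp: pverts_corona copy_def)
  then show ?thesis
    using dist_other_root_to_copy[OF assms(1-4)] gdist_leave_copy assms(1,5)
    by (auto simp: copy_def)
qed

text \<open>
  A suitable copy is one attached to, or containing, one of the two vertices, unless the pair
  consists of a vertex and its own root. Then any other copy serves, the root being one step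
  closer to it; this is where \<open>G\<close> has to have a second vertex.
\<close>

lemma copy_resolves_other_pairs:
  assumes a: "a \<in> pverts (corona G H)" and b: "b \<in> pverts (corona G H)" and "a \<noteq> b"
    and apart: "\<And>v. v \<in> pverts G \<Longrightarrow> \<not> (a \<in> copy v \<and> b \<in> copy v)"
  shows "\<exists>t\<in>pverts G. copy t \<subseteq> resolvers (corona G H) a b"
proof -
  have copy_verts: "copy v \<subseteq> pverts (corona G H)" if "v \<in> pverts G" for v
    using that by (auto simp: pverts_corona)
  have copy_resolvesI: "copy v \<subseteq> resolvers (corona G H) c c'"
    if "\<And>w. w \<in> copy v \<Longrightarrow> dist_K c w \<noteq> dist_K c' w" "v \<in> pverts G" for v c c'
    unfolding resolvers_def using that copy_verts by blast
  have root_copy: "\<exists>t\<in>pverts G. copy t \<subseteq> resolvers (corona G H) (Inl u) c"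
    if u: "u \<in> pverts G" and v: "v \<in> pverts G" and c: "c \<in> copy v" for u v c
  proof (cases "u = v")
    case True
    have "\<not> pverts G \<subseteq> {u}"
      using nontrivial_G card_mono[of "{u}" "pverts G"] by (auto simp: nontrivial_graph_def)
    then obtain t where t: "t \<in> pverts G" "t \<noteq> u"
      by blast
    have "dist_K (Inl u) w \<noteq> dist_K c w" if w: "w \<in> copy t" for w
    proof -
      have "w \<in> pverts (corona G H)" "w \<notin> copy u"
        using w t copy_verts by (auto simp: copy_def)
      then show ?thesis
        using gdist_leave_copy u c True by (auto simp: copy_def)
    qed
    then show ?thesis
      using t by (intro bexI[of _ t] copy_resolvesI)
  next
    case False
    then have "dist_K (Inl u) w \<noteq> dist_K c w" if "w \<in> copy u" for w
      using dist_root_to_copy[OF u that] dist_other_copy_to_copy[OF v u _ that c] by simp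
    then show ?thesis
      using u by (intro bexI[of _ u] copy_resolvesI)
  qed
  have roots: "\<exists>t\<in>pverts G. copy t \<subseteq> resolvers (corona G H) (Inl u) (Inl v)"
    if u: "u \<in> pverts G" and v: "v \<in> pverts G" and "u \<noteq> v" for u v
  proof -
    have "dist_K (Inl u) w \<noteq> dist_K (Inl v) w" if "w \<in> copy u" for w
      using dist_root_to_copy[OF u that] dist_other_root_to_copy[OF v u _ that] \<open>u \<noteq> v\<close> by simp
    then show ?thesis
      using u by (intro bexI[of _ u] copy_resolvesI)
  qed
  have copies: "\<exists>t\<in>pverts G. copy t \<subseteq> resolvers (corona G H) a b"
    if u: "u \<in> pverts G" and v: "v \<in> pverts G" and "u \<noteq> v" and "a \<in> copy u" "b \<in> copy v" for u v
  proof -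
    have "dist_K a w \<noteq> dist_K b w" if w: "w \<in> copy u" for w
    proof -
      have "dist_K a w \<le> 2"
        using w \<open>a \<in> copy u\<close> u by (auto simp: copy_def gdist_in_copy)
      then show ?thesis
        using dist_other_copy_to_copy[OF v u _ w \<open>b \<in> copy v\<close>] \<open>u \<noteq> v\<close> by simp
    qed
    then show ?thesis
      using u by (intro bexI[of _ u] copy_resolvesI)
  qed
  consider u v where "u \<in> pverts G" "v \<in> pverts G" "a = Inl u" "b = Inl v"
    | u v where "u \<in> pverts G" "v \<in> pverts G" "a = Inl u" "b \<in> copy v"
    | u v where "u \<in> pverts G" "v \<in> pverts G" "a \<in> copy u" "b = Inl v"
    | u v where "u \<in> pverts G" "v \<in> pverts G" "a \<in> copy u" "b \<in> copy v"
    using a b unfolding pverts_corona by blast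
  then show ?thesis
  proof cases
    case (1 u v)
    then show ?thesis using roots \<open>a \<noteq> b\<close> by blast
  next
    case (2 u v)
    then show ?thesis using root_copy by blast
  next
    case (3 u v)
    then show ?thesis using root_copy[of v u a] by (simp add: resolvers_commute)
  next
    case (4 u v)
    then show ?thesis using copies[of u v] apart by blast
  qed
qed

text \<open>
  Pairs inside a copy contribute exactly the cardinalities of which \<open>\<C>\<close> of that copy is the minimum;
  all other pairs contribute at least the order of some copy, which is no less than its \<open>\<C>\<close>.
\<close>

lemma le_card_resolvers_iff_le_cal_C_family:
  "(\<forall>a\<in>pverts (corona G H). \<forall>b\<in>pverts (corona G H). a \<noteq> b \<longrightarrow>
      k \<le> card (resolvers (corona G H) a b)) \<longleftrightarrow> k \<le> cal_C_family (pverts G) H"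
    (is "?L \<longleftrightarrow> _")
proof -
  have "pverts G \<noteq> {}"
    using nontrivial_G by (auto simp: nontrivial_graph_def)
  then have family: "k \<le> cal_C_family (pverts G) H \<longleftrightarrow> (\<forall>v\<in>pverts G. k \<le> cal_C (H v))"
    using G.pair_finite_verts by (rule le_cal_C_family_iff[rotated])
  have same_copy: "card (resolvers (corona G H) (Inr (v, x)) (Inr (v, y))) =
      card (sym_diff (nbhd (H v) x) (nbhd (H v) y) \<union> {x, y})"
    if "v \<in> pverts G" "x \<in> pverts (H v)" "y \<in> pverts (H v)" "x \<noteq> y" for v x y
    unfolding resolvers_same_copy[OF that] by (rule card_image) (simp add: inj_on_def)
  show ?thesis
    unfolding family
  proof
    assume L: ?L
    show "\<forall>v\<in>pverts G. k \<le> cal_C (H v)"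
    proof
      fix v assume v: "v \<in> pverts G"
      have "k \<le> card (sym_diff (nbhd (H v) x) (nbhd (H v) y) \<union> {x, y})"
        if "x \<in> pverts (H v)" "y \<in> pverts (H v)" "x \<noteq> y" for x y
      proof -
        have "Inr (v, x) \<in> pverts (corona G H)" "Inr (v, y) \<in> pverts (corona G H)"
          using v that by (auto simp: pverts_corona copy_def)
        then show ?thesis
          using L that(3) unfolding same_copy[OF v that, symmetric] by simp
      qed
      then show "k \<le> cal_C (H v)"
        by (simp add: le_cal_C_iff[OF nontrivial_H[OF v]])
    qed
  next
    assume R: "\<forall>v\<in>pverts G. k \<le> cal_C (H v)"
    show ?L
    proof (intro ballI impI)
      fix a b assume ab: "a \<in> pverts (corona G H)" "b \<in> pverts (corona G H)" "a \<noteq> b"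
      show "k \<le> card (resolvers (corona G H) a b)"
      proof (cases "\<exists>v\<in>pverts G. a \<in> copy v \<and> b \<in> copy v")
        case True
        then obtain v x y where "v \<in> pverts G" "x \<in> pverts (H v)" "y \<in> pverts (H v)"
          "a = Inr (v, x)" "b = Inr (v, y)"
          by (auto simp: copy_def)
        then show ?thesis
          using R ab(3) same_copy le_cal_C_iff[OF nontrivial_H] by auto
      next
        case False
        then obtain v where v: "v \<in> pverts G" "copy v \<subseteq> resolvers (corona G H) a b"
          using copy_resolves_other_pairs[OF ab] by blast
        have "k \<le> card (pverts (H v))"
          using R cal_C_le_card_pverts[OF nontrivial_H] v(1) le_trans by blast
        also have "\<dots> \<le> card (resolvers (corona G H) a b)"
          unfolding card_copy[symmetric]
          using v(2) K.pair_finite_verts by (intro card_mono) (auto simp: resolvers_def)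
        finally show ?thesis .
      qed
    qed
  qed
qed

lemma cal_C_family_pos: "0 < cal_C_family (pverts G) H"
proof -
  have "pverts G \<noteq> {}"
    using nontrivial_G by (auto simp: nontrivial_graph_def)
  then have "2 \<le> cal_C_family (pverts G) H"
    using G.pair_finite_verts cal_C_ge_2[OF nontrivial_H] by (simp add: le_cal_C_family_iff)
  then show ?thesis by simp
qed

end

theorem theorem5:
  fixes G :: "'a pair_pre_digraph"
    and H :: "'a \<Rightarrow> 'b pair_pre_digraph"
    and k :: nat
  assumes "nontrivial_graph G"
    and "connected (with_proj G)"
    and "\<And>v. v \<in> pverts G \<Longrightarrow> nontrivial_graph (H v)"
    and "0 < k"
  shows "k_metric_dimensional k (corona G H) \<longleftrightarrow> k = cal_C_family (pverts G) H"
proof -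
  interpret corona_graph G H
    using assms(1-3) by unfold_locales
  have basis: "(\<exists>S. k_metric_basis k' (corona G H) S) \<longleftrightarrow>
      0 < k' \<and> k' \<le> cal_C_family (pverts G) H" for k'
    using k_metric_basis_exists_iff[OF K.pair_finite_verts]
    by (simp add: le_card_resolvers_iff_le_cal_C_family)
  show ?thesis
    unfolding k_metric_dimensional_def basis
    using connected_corona cal_C_family_pos by (auto intro: antisym)
qed

end
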